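(* Consider the linear regression model for a mixture with varying concentrations described in the context, and fix a component number $m\in\{1,\dots,M\}$. Assume that 1. $\mathbf D^{(k)}$ and $(\sigma^{(k)})^2$ are finite for all $k=1,\dots,M$. 2. $\mathbf D^{(m)}$ is nonsingular. 3. There exists $C>0$ such that $\det\boldsymbol\Gamma_N>C$ for all $N$ large enough. Then $\hat{\mathbf b}^{(m)}_{;N}\to\mathbf b^{(m)}$ in probability as $N\to\infty$.
   Context: **Model.** Fix integers $M\ge1$ (number of mixture components) and $d\ge1$ (number of regressors). For each sample size $N=1,2,\dots$ one has subjects $O_1,\dots,O_N$. Subject $O_j$ has an unobserved component number $\kappa_j=\kappa(O_j)\in\{1,\dots,M\}$ with known probabilities $p_{j;N}^k=\mathsf P\{\kappa_j=k\}$, $k=1,\dots,M$ (so $p_{j;N}^k\ge0$ and $\sum_{k=1}^M p_{j;N}^k=1$), and an observed vector $\xi_j=(Y_j,X_j^1,\dots,X_j^d)^T$. The variables satisfy $$Y_j=\sum_{i=1}^d b_i^{(\kappa_j)}X_j^i+\varepsilon_j,$$ where $\mathbf b^{(k)}=(b_1^{(k)},\dots,b_d^{(k)})^T\in\mathbb R^d$, $k=1,\dots,M$, are nonrandom coefficient vectors. Given $\kappa_j=k$, the joint distribution of the regressor vector $\mathbf X(O_j)=(X_j^1,\dots,X_j^d)^T$ and the error $\varepsilon_j$ depends only on $k$ (not on $j$ or $N$); $\varepsilon_j$ is conditionally independent of $\mathbf X(O_j)$ given $\kappa_j$, and has conditional mean zero. For each $N$, the pairs $(\kappa_j,\xi_j)$,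 $j=1,\dots,N$, are independent. The data form a triangular array (the index $N$ is suppressed in $\kappa_j,\xi_j$): no relation between the data for different $N$ is assumed. Write $O$ for a generic subject, so that $\mathsf E[\,\cdot\,|\,\kappa(O)=k]$ denotes expectation under the distribution of the $k$th component (the common conditional distribution given $\kappa_j=k$). **Moments.** $\mathbf D^{(k)}=\mathsf E[\mathbf X(O)\mathbf X(O)^T\,|\,\kappa(O)=k]$ is the $d\times d$ matrix of second moments of the regressors, and $(\sigma^{(k)})^2=\mathsf E[\varepsilon(O)^2\,|\,\kappa(O)=k]$. **Weights.** $\boldsymbol\Gamma_N$ is the $M\times M$ matrix with entries $\frac1N\sum_{j=1}^N p_{j;N}^l p_{j;N}^k$, $l,k=1,\dots,M$. Let $\gamma_{lk;N}$ be its $(l,k)$th minor (the determinant of the matrix obtained by deleting row $l$ and column $k$). When $\boldsymbol\Gamma_N$ is nonsingular, put $$a_{j;N}^m=\frac1{\det\boldsymbol\Gamma_N}\sum_{k=1}^M(-1)^{k+m}\gamma_{mk;N}\,p_{j;N}^k,$$ that is, $a_{j;N}^m=\sum_{k=1}^M(\boldsymbol\Gamma_N^{-1})_{mk}\,p_{j;N}^k$. These weights may be negative. **Estimator (modified least squares, MVC-LS).** Let $\mathbf X=(X_j^i)_{j=1,\dots,N;\,i=1,\dots,d}$ be the $N\times d$ matrix of observed regressors, $\mathbf Y=(Y_1,\dots,Y_N)^T$, and $\mathbf A=\operatorname{diag}(a_{1;N}^m,\dots,a_{N;N}^m)$. Then $$\hat{\mathbf b}^{(m)}_{;N}=(\mathbf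 X^T\mathbf A\mathbf X)^{-1}\mathbf X^T\mathbf A\mathbf Y.$$ On the event where $\mathbf X^T\mathbf A\mathbf X$ is singular, and for those (finitely many, under assumption 3) $N$ with $\boldsymbol\Gamma_N$ singular, the estimator is assigned an arbitrary value, e.g. $0$. *)

theory Defs
  imports "HOL-Probability.Probability"
begin

text \<open>
  The mixture components are the elements of a finite type \<open>'k\<close>, the regressors are indexed by a
  finite type \<open>'d\<close>. The data form a triangular array: for every sample size \<open>N \<ge> 1\<close> the subjects
  \<open>1, \<dots>, N\<close> live on a probability space \<open>P N\<close> of their own. The measures \<open>FX k\<close> and \<open>Fe k\<close> are
  the distributions of the regressor vector and of the error in component \<open>k\<close>.
\<close>

locale mixture_regression =
  fixes P :: "nat \<Rightarrow> 'w measure"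
    and p :: "nat \<Rightarrow> nat \<Rightarrow> real ^ 'k"
    and \<kappa> :: "nat \<Rightarrow> nat \<Rightarrow> 'w \<Rightarrow> 'k"
    and X :: "nat \<Rightarrow> nat \<Rightarrow> 'w \<Rightarrow> real ^ 'd"
    and \<epsilon> :: "nat \<Rightarrow> nat \<Rightarrow> 'w \<Rightarrow> real"
    and Y :: "nat \<Rightarrow> nat \<Rightarrow> 'w \<Rightarrow> real"
    and b :: "'k \<Rightarrow> real ^ 'd"
    and FX :: "'k \<Rightarrow> (real ^ 'd) measure"
    and Fe :: "'k \<Rightarrow> real measure"
  assumes prob_space_P: "N \<ge> 1 \<Longrightarrow> prob_space (P N)"
    and prob_space_FX: "prob_space (FX k)" and sets_FX: "sets (FX k) = sets borel"
    and prob_space_Fe: "prob_space (Fe k)" and sets_Fe: "sets (Fe k) = sets borel"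
    and independent: "N \<ge> 1 \<Longrightarrow>
          prob_space.indep_vars (P N) (\<lambda>_. count_space UNIV \<Otimes>\<^sub>M (borel \<Otimes>\<^sub>M borel))
            (\<lambda>j \<omega>. (\<kappa> N j \<omega>, (Y N j \<omega>, X N j \<omega>))) {1..N}"
    and prob_component: "j \<in> {1..N} \<Longrightarrow>
          measure (P N) {\<omega> \<in> space (P N). \<kappa> N j \<omega> = k} = p N j $ k"
    \<comment> \<open>The joint law given the component is a product measure: this is the conditional
      independence of the regressors and the error.\<close>
    and law_given_component: "j \<in> {1..N} \<Longrightarrow> p N j $ k > 0 \<Longrightarrow>
          distr (uniform_measure (P N) {\<omega> \<in> space (P N). \<kappa> N j \<omega> = k}) (borel \<Otimes>\<^sub>M borel)
            (\<lambda>\<omega>. (X N j \<omega>, \<epsilon> N j \<omega>)) = FX k \<Otimes>\<^sub>M Fe k"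
    and error_integrable: "integrable (Fe k) (\<lambda>e. e)"
    and error_mean_zero: "(\<integral>e. e \<partial>Fe k) = 0"
    and regression: "j \<in> {1..N} \<Longrightarrow> \<omega> \<in> space (P N) \<Longrightarrow>
          Y N j \<omega> = (\<Sum>i\<in>UNIV. b (\<kappa> N j \<omega>) $ i * X N j \<omega> $ i) + \<epsilon> N j \<omega>"

definition second_moment_matrix :: "(real ^ 'd) measure \<Rightarrow> real ^ 'd ^ 'd" where
  "second_moment_matrix F = (\<chi> i l. \<integral>x. x $ i * x $ l \<partial>F)"

definition conc_gram :: "(nat \<Rightarrow> nat \<Rightarrow> real ^ 'k) \<Rightarrow> nat \<Rightarrow> real ^ 'k ^ 'k" where
  "conc_gram p N = (\<chi> l k. (1 / real N) * (\<Sum>j=1..N. p N j $ l * p N j $ k))"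

definition minimax_weight :: "(nat \<Rightarrow> nat \<Rightarrow> real ^ 'k) \<Rightarrow> 'k \<Rightarrow> nat \<Rightarrow> nat \<Rightarrow> real" where
  "minimax_weight p m N j = (\<Sum>k\<in>UNIV. matrix_inv (conc_gram p N) $ m $ k * p N j $ k)"

text \<open>
  For weights \<open>a\<close>, regressors \<open>x\<close> and responses \<open>y\<close> of the subjects \<open>1, \<dots>, N\<close>, these are the
  matrix \<open>X\<^sup>T A X\<close> and the vector \<open>X\<^sup>T A Y\<close> with \<open>A = diag (a 1, \<dots>, a N)\<close>; the design matrix has
  a variable number \<open>N\<close> of rows, so the products are written out.
\<close>

definition weighted_gram :: "nat \<Rightarrow> (nat \<Rightarrow> real) \<Rightarrow> (nat \<Rightarrow> real ^ 'd) \<Rightarrow> real ^ 'd ^ 'd" where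
  "weighted_gram N a x = (\<chi> i l. \<Sum>j=1..N. x j $ i * a j * x j $ l)"

definition weighted_cross ::
    "nat \<Rightarrow> (nat \<Rightarrow> real) \<Rightarrow> (nat \<Rightarrow> real ^ 'd) \<Rightarrow> (nat \<Rightarrow> real) \<Rightarrow> real ^ 'd" where
  "weighted_cross N a x y = (\<chi> i. \<Sum>j=1..N. x j $ i * a j * y j)"

text \<open>The vector \<open>v\<close> is the value of the estimator where one of the inverses does not exist.\<close>

definition mvc_ls ::
    "(nat \<Rightarrow> nat \<Rightarrow> real ^ 'k) \<Rightarrow> 'k \<Rightarrow> nat \<Rightarrow> (nat \<Rightarrow> real ^ 'd) \<Rightarrow> (nat \<Rightarrow> real) \<Rightarrow>
      real ^ 'd \<Rightarrow> real ^ 'd" where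
  "mvc_ls p m N x y v =
    (let a = minimax_weight p m N in
     if invertible (conc_gram p N) \<and> invertible (weighted_gram N a x)
     then matrix_inv (weighted_gram N a x) *v weighted_cross N a x y
     else v)"

end

theory Submission
  imports Defs
begin

text \<open>
  The true coefficients \<open>b m\<close> of component \<open>m\<close> solve the population normal equations
  \<open>second_moment_matrix (FX m) *v b m = c\<close>, where \<open>c\<close> is the vector of mixed moments of the
  regressors and the response in this component: the error is centred and independent of the
  regressors, so it does not enter \<open>c\<close>. The estimator solves the same equations with the moments
  replaced by weighted sample means
  \<open>(\<Sum>j=1..N. minimax_weight p m N j * h (Y j, X j)) / N\<close>, where \<open>h\<close> is a product of two regressors
  or of a regressor and the response. By Cramer's rule the solution of an invertible system depends
  continuously on its matrix and its right-hand side (\<open>continuous_linear_solution\<close>). Hence it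
  suffices that every weighted mean converges in probability to the mean of \<open>h\<close> in component \<open>m\<close>
  (\<open>weighted_mean_tendsto_in_probability\<close>).

  The expectation of a weighted mean is already right. A subject has a law which mixes the component
  laws with its concentrations, and the weights are built from the inverse of the Gram matrix of the
  concentrations, so that averaging them against the concentrations of component \<open>k\<close> gives 1 for
  \<open>k = m\<close> and 0 otherwise (\<open>minimax_weight_biorthogonal\<close>).

  The fluctuations vanish by a weak law of large numbers for rowwise independent, uniformly
  integrable arrays with bounded weights (\<open>weak_law_weighted_triangular_array\<close>). Products of
  regressors are assumed to have a first moment only, so their variance may be infinite, and the law
  is proved by truncation. Uniform integrability holds because there are finitely many components.
  The lower bound on the determinant of the Gram matrix keeps the weights bounded
  (\<open>abs_minimax_weight_le\<close>).
\<close>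

section \<open>A weak law of large numbers for weighted triangular arrays\<close>

lemma (in prob_space) expectation_abs_le_sqrt:
  fixes W :: "'a \<Rightarrow> real"
  assumes "integrable M W" "integrable M (\<lambda>x. (W x)\<^sup>2)"
  shows "expectation (\<lambda>x. \<bar>W x\<bar>) \<le> sqrt (expectation (\<lambda>x. (W x)\<^sup>2))"
proof (rule real_le_rsqrt)
  have "variance (\<lambda>x. \<bar>W x\<bar>) = expectation (\<lambda>x. (W x)\<^sup>2) - (expectation (\<lambda>x. \<bar>W x\<bar>))\<^sup>2"
    by (subst variance_eq) (use assms in auto)
  then show "(expectation (\<lambda>x. \<bar>W x\<bar>))\<^sup>2 \<le> expectation (\<lambda>x. (W x)\<^sup>2)"
    using variance_positive[of "\<lambda>x. \<bar>W x\<bar>"] by simp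
qed

text \<open>
  Independence kills the mixed terms in the second moment of the centred sum, so only the
  \<open>card I\<close> variances, each at most \<open>B\<^sup>2\<close>, remain.
\<close>

lemma (in prob_space) expectation_abs_centered_sum_le_bounded:
  fixes T :: "'i \<Rightarrow> 'a \<Rightarrow> real"
  assumes I: "finite I" and ind: "indep_vars (\<lambda>_. borel) T I"
    and bound: "\<And>j x. j \<in> I \<Longrightarrow> x \<in> space M \<Longrightarrow> \<bar>T j x\<bar> \<le> B" and B: "0 \<le> B"
  shows "expectation (\<lambda>x. \<bar>\<Sum>j\<in>I. T j x - expectation (T j)\<bar>) \<le> sqrt (real (card I)) * B"
proof -
  define W where "W j x = T j x - expectation (T j)" for j x
  have rv[measurable]: "random_variable borel (T j)" if "j \<in> I" for j
    using ind that by (auto simp: indep_vars_def)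
  have int_T: "integrable M (T j)" if "j \<in> I" for j
    by (rule integrable_const_bound[where B=B]) (use that bound in auto)
  have int_T2: "integrable M (\<lambda>x. (T j x)\<^sup>2)" if "j \<in> I" for j
  proof (rule integrable_const_bound[where B="B\<^sup>2"])
    show "AE x in M. norm ((T j x)\<^sup>2) \<le> B\<^sup>2"
    proof (rule AE_I2)
      fix x assume "x \<in> space M"
      then show "norm ((T j x)\<^sup>2) \<le> B\<^sup>2"
        using power_mono[OF bound[OF that], of x 2] by simp
    qed
  qed (use that in auto)
  have int_W: "integrable M (W j)" if "j \<in> I" for j
    unfolding W_def by (intro Bochner_Integration.integrable_diff int_T that) auto
  have mean_W: "expectation (W j) = 0" if "j \<in> I" for j
    unfolding W_def by (subst Bochner_Integration.integral_diff) (use int_T that in \<open>auto simp: prob_space\<close>)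
  have ind_W: "indep_vars (\<lambda>_. borel) W I"
    using indep_vars_compose2[OF ind, of "\<lambda>j t. t - expectation (T j)" "\<lambda>_. borel"]
    by (simp add: W_def[abs_def])
  have int_W2: "integrable M (\<lambda>x. W j x * W j x)" if "j \<in> I" for j
  proof -
    have "integrable M (\<lambda>x. (T j x)\<^sup>2 - 2 * expectation (T j) * T j x + (expectation (T j))\<^sup>2)"
      by (intro Bochner_Integration.integrable_add Bochner_Integration.integrable_diff int_T2 that
          integrable_mult_right int_T) auto
    then show ?thesis by (simp add: W_def power2_eq_square algebra_simps)
  qed
  have var_W: "expectation (\<lambda>x. W j x * W j x) \<le> B\<^sup>2" if "j \<in> I" for j
  proof -
    have "expectation (\<lambda>x. W j x * W j x) = expectation (\<lambda>x. (T j x)\<^sup>2) - (expectation (T j))\<^sup>2"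
      using variance_eq[OF int_T int_T2, OF that that] by (simp add: W_def power2_eq_square)
    also have "\<dots> \<le> expectation (\<lambda>x. (T j x)\<^sup>2)" by simp
    also have "\<dots> \<le> expectation (\<lambda>_. B\<^sup>2)"
      using power_mono[OF bound[OF that], of _ 2] by (intro integral_mono int_T2 that) auto
    finally show ?thesis by (simp add: prob_space)
  qed
  have cross: "integrable M (\<lambda>x. W i x * W j x)" "expectation (\<lambda>x. W i x * W j x) = 0"
    if "i \<in> I" "j \<in> I" "i \<noteq> j" for i j
  proof -
    have "indep_vars (\<lambda>_. borel) W {i, j}"
      by (rule indep_vars_subset[OF ind_W]) (use that in auto)
    moreover have "finite {i, j}" by simp
    moreover have "\<And>k. k \<in> {i, j} \<Longrightarrow> integrable M (W k)" using int_W that by auto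
    ultimately show "integrable M (\<lambda>x. W i x * W j x)" "expectation (\<lambda>x. W i x * W j x) = 0"
      using indep_vars_integrable[of "{i,j}" W] indep_vars_lebesgue_integral[of "{i,j}" W] that
        mean_W by auto
  qed
  have int_prod: "integrable M (\<lambda>x. W i x * W j x)" if "i \<in> I" "j \<in> I" for i j
    using that cross(1) int_W2 by (cases "i = j") auto
  have square: "(\<Sum>j\<in>I. W j x)\<^sup>2 = (\<Sum>i\<in>I. \<Sum>j\<in>I. W i x * W j x)" for x
    by (simp add: power2_eq_square sum_product)
  have int_S: "integrable M (\<lambda>x. \<Sum>j\<in>I. W j x)"
    by (intro Bochner_Integration.integrable_sum int_W)
  have int_S2: "integrable M (\<lambda>x. (\<Sum>j\<in>I. W j x)\<^sup>2)"
    unfolding square by (intro Bochner_Integration.integrable_sum int_prod)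
  have "expectation (\<lambda>x. (\<Sum>j\<in>I. W j x)\<^sup>2) = (\<Sum>i\<in>I. \<Sum>j\<in>I. expectation (\<lambda>x. W i x * W j x))"
    unfolding square
    by (subst Bochner_Integration.integral_sum)
       (auto intro!: Bochner_Integration.integrable_sum int_prod sum.cong Bochner_Integration.integral_sum)
  also have "\<dots> = (\<Sum>i\<in>I. expectation (\<lambda>x. W i x * W i x))"
  proof (rule sum.cong[OF refl])
    fix i assume i: "i \<in> I"
    have "(\<Sum>j\<in>I. expectation (\<lambda>x. W i x * W j x))
        = (\<Sum>j\<in>I. if j = i then expectation (\<lambda>x. W i x * W i x) else 0)"
      using cross(2) i by (intro sum.cong) auto
    then show "(\<Sum>j\<in>I. expectation (\<lambda>x. W i x * W j x)) = expectation (\<lambda>x. W i x * W i x)"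
      using I i by simp
  qed
  also have "\<dots> \<le> real (card I) * B\<^sup>2"
    using sum_bounded_above[of I _ "B\<^sup>2"] var_W by simp
  finally have "sqrt (expectation (\<lambda>x. (\<Sum>j\<in>I. W j x)\<^sup>2)) \<le> sqrt (real (card I)) * B"
    using B by (metis real_sqrt_le_mono real_sqrt_mult real_sqrt_unique)
  with expectation_abs_le_sqrt[OF int_S int_S2] show ?thesis
    by (simp add: W_def)
qed

text \<open>
  Only first moments are available, so the variance bound is applied to the parts of the \<open>Z j\<close>
  below a level \<open>L\<close>. The remaining parts are small in mean, which does not improve with
  independence: each of them, and its expectation, contributes \<open>K * \<tau>\<close>.
\<close>

lemma (in prob_space) expectation_abs_centered_sum_le_truncated:
  fixes Z :: "'i \<Rightarrow> 'a \<Rightarrow> real"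
  assumes I: "finite I" and ind: "indep_vars (\<lambda>_. borel) Z I"
    and int: "\<And>j. j \<in> I \<Longrightarrow> integrable M (Z j)"
    and a: "\<And>j. j \<in> I \<Longrightarrow> \<bar>a j\<bar> \<le> K"
    and tail: "\<And>j. j \<in> I \<Longrightarrow> expectation (\<lambda>x. if \<bar>Z j x\<bar> > L then \<bar>Z j x\<bar> else 0) \<le> \<tau>"
    and K: "0 \<le> K" and L: "0 \<le> L" and \<tau>: "0 \<le> \<tau>"
  shows "expectation (\<lambda>x. \<bar>\<Sum>j\<in>I. a j * (Z j x - expectation (Z j))\<bar>)
           \<le> sqrt (real (card I)) * (K * L) + real (card I) * (2 * K * \<tau>)"
proof -
  have rv[measurable]: "random_variable borel (Z j)" if "j \<in> I" for j
    using ind that by (auto simp: indep_vars_def)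
  define T where "T j x = (if \<bar>Z j x\<bar> > L then 0 else a j * Z j x)" for j x
  define R where "R j x = (if \<bar>Z j x\<bar> > L then a j * Z j x else 0)" for j x
  have ind_T: "indep_vars (\<lambda>_. borel) T I"
    unfolding T_def[abs_def]
    by (rule indep_vars_compose2[OF ind, of "\<lambda>j t. if \<bar>t\<bar> > L then 0 else a j * t" "\<lambda>_. borel"]) simp
  have bound_T: "\<bar>T j x\<bar> \<le> K * L" if "j \<in> I" for j x
    using a[OF that] K L by (auto simp: T_def abs_mult intro!: mult_mono)
  have rvT[measurable]: "random_variable borel (T j)" if "j \<in> I" for j
    using that unfolding T_def[abs_def] by measurable
  have rvR[measurable]: "random_variable borel (R j)" if "j \<in> I" for j
    using that unfolding R_def[abs_def] by measurable
  have int_aZ: "integrable M (\<lambda>x. a j * Z j x)" if "j \<in> I" for j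
    using int[OF that] by simp
  have int_T: "integrable M (T j)" if "j \<in> I" for j
    by (rule Bochner_Integration.integrable_bound[OF int_aZ[OF that]]) (use that in \<open>auto simp: T_def\<close>)
  have int_R: "integrable M (R j)" if "j \<in> I" for j
    by (rule Bochner_Integration.integrable_bound[OF int_aZ[OF that]]) (use that in \<open>auto simp: R_def\<close>)
  have int_tail: "integrable M (\<lambda>x. if \<bar>Z j x\<bar> > L then \<bar>Z j x\<bar> else 0)" if "j \<in> I" for j
    by (rule Bochner_Integration.integrable_bound[OF int[OF that]]) (use that in auto)
  have abs_R: "expectation (\<lambda>x. \<bar>R j x\<bar>) \<le> K * \<tau>" if "j \<in> I" for j
  proof -
    have "expectation (\<lambda>x. \<bar>R j x\<bar>)
        \<le> expectation (\<lambda>x. K * (if \<bar>Z j x\<bar> > L then \<bar>Z j x\<bar> else 0))"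
      by (intro integral_mono integrable_abs int_R integrable_mult_right int_tail that)
         (use a[OF that] in \<open>auto simp: R_def abs_mult intro: mult_right_mono\<close>)
    also have "\<dots> \<le> K * \<tau>"
      using tail[OF that] K by (simp add: mult_left_mono)
    finally show ?thesis .
  qed
  have split: "a j * (Z j x - expectation (Z j)) = (T j x - expectation (T j)) + (R j x - expectation (R j))"
    if "j \<in> I" for j x
  proof -
    have "a j * expectation (Z j) = expectation (\<lambda>x. T j x + R j x)"
      by (subst Bochner_Integration.integral_mult_right_zero[symmetric],
          intro Bochner_Integration.integral_cong) (auto simp: T_def R_def)
    also have "\<dots> = expectation (T j) + expectation (R j)"
      using int_T int_R that by simp
    finally show ?thesis by (auto simp: T_def R_def algebra_simps)
  qed
  have abs_R_centered: "expectation (\<lambda>x. \<bar>R j x - expectation (R j)\<bar>) \<le> 2 * K * \<tau>" if "j \<in> I" for j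
  proof -
    have "expectation (\<lambda>x. \<bar>R j x - expectation (R j)\<bar>)
        \<le> expectation (\<lambda>x. \<bar>R j x\<bar> + \<bar>expectation (R j)\<bar>)"
      by (intro integral_mono) (use int_R[OF that] in auto)
    also have "\<dots> = expectation (\<lambda>x. \<bar>R j x\<bar>) + \<bar>expectation (R j)\<bar>"
      using int_R[OF that] by (simp add: prob_space)
    also have "\<dots> \<le> 2 * K * \<tau>"
      using abs_R[OF that] integral_abs_bound[of M "R j"] by linarith
    finally show ?thesis .
  qed
  have int_TS: "integrable M (\<lambda>x. \<Sum>j\<in>I. T j x - expectation (T j))"
    by (intro Bochner_Integration.integrable_sum Bochner_Integration.integrable_diff int_T) auto
  have int_Rabs: "integrable M (\<lambda>x. \<bar>R j x - expectation (R j)\<bar>)" if "j \<in> I" for j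
    using int_R[OF that] by simp
  have "expectation (\<lambda>x. \<bar>\<Sum>j\<in>I. a j * (Z j x - expectation (Z j))\<bar>)
      \<le> expectation (\<lambda>x. \<bar>\<Sum>j\<in>I. T j x - expectation (T j)\<bar> + (\<Sum>j\<in>I. \<bar>R j x - expectation (R j)\<bar>))"
  proof (rule integral_mono)
    show "integrable M (\<lambda>x. \<bar>\<Sum>j\<in>I. a j * (Z j x - expectation (Z j))\<bar>)"
      by (intro integrable_abs Bochner_Integration.integrable_sum integrable_mult_right
          Bochner_Integration.integrable_diff int) auto
    show "integrable M (\<lambda>x. \<bar>\<Sum>j\<in>I. T j x - expectation (T j)\<bar> + (\<Sum>j\<in>I. \<bar>R j x - expectation (R j)\<bar>))"
      by (intro Bochner_Integration.integrable_add integrable_abs int_TS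
          Bochner_Integration.integrable_sum int_Rabs)
    fix x
    have "(\<Sum>j\<in>I. a j * (Z j x - expectation (Z j)))
        = (\<Sum>j\<in>I. T j x - expectation (T j)) + (\<Sum>j\<in>I. R j x - expectation (R j))"
      by (simp add: split flip: sum.distrib)
    then show "\<bar>\<Sum>j\<in>I. a j * (Z j x - expectation (Z j))\<bar>
        \<le> \<bar>\<Sum>j\<in>I. T j x - expectation (T j)\<bar> + (\<Sum>j\<in>I. \<bar>R j x - expectation (R j)\<bar>)"
      using sum_abs[of "\<lambda>j. R j x - expectation (R j)" I] by linarith
  qed
  also have "\<dots> = expectation (\<lambda>x. \<bar>\<Sum>j\<in>I. T j x - expectation (T j)\<bar>)
      + (\<Sum>j\<in>I. expectation (\<lambda>x. \<bar>R j x - expectation (R j)\<bar>))"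
    using int_Rabs by (subst Bochner_Integration.integral_add)
      (auto intro!: integrable_abs int_TS Bochner_Integration.integrable_sum Bochner_Integration.integral_sum)
  also have "\<dots> \<le> sqrt (real (card I)) * (K * L) + real (card I) * (2 * K * \<tau>)"
    using K L sum_bounded_above[of I _ "2 * K * \<tau>"] abs_R_centered
    by (intro add_mono expectation_abs_centered_sum_le_bounded[OF I ind_T bound_T]) auto
  finally show ?thesis .
qed

text \<open>
  After division by \<open>N\<close>, the truncated parts contribute at most \<open>K * L / sqrt N\<close> and the tails at
  most \<open>2 * K * \<tau>\<close> in mean. The assumption on the tails is the uniform integrability
  of the array; it makes \<open>\<tau>\<close> as small as desired with \<open>L\<close> independent of \<open>N\<close>.
\<close>

theorem weak_law_weighted_triangular_array:
  fixes M :: "nat \<Rightarrow> 'a measure" and Z :: "nat \<Rightarrow> nat \<Rightarrow> 'a \<Rightarrow> real" and a :: "nat \<Rightarrow> nat \<Rightarrow> real"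
  assumes prob: "\<And>N. N \<ge> 1 \<Longrightarrow> prob_space (M N)"
    and ind: "\<And>N. N \<ge> 1 \<Longrightarrow> prob_space.indep_vars (M N) (\<lambda>_. borel) (Z N) {1..N}"
    and int: "\<And>N j. j \<in> {1..N} \<Longrightarrow> integrable (M N) (Z N j)"
    and tail: "\<And>\<tau>. \<tau> > 0 \<Longrightarrow> \<exists>L. \<forall>N. \<forall>j\<in>{1..N}.
        (\<integral>x. (if \<bar>Z N j x\<bar> > L then \<bar>Z N j x\<bar> else 0) \<partial>M N) \<le> \<tau>"
    and a: "eventually (\<lambda>N. \<forall>j\<in>{1..N}. \<bar>a N j\<bar> \<le> K) sequentially"
    and \<eta>: "\<eta> > 0"
  shows "(\<lambda>N. measure (M N) {x \<in> space (M N).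
            \<bar>(\<Sum>j=1..N. a N j * (Z N j x - (\<integral>y. Z N j y \<partial>M N))) / real N\<bar> \<ge> \<eta>}) \<longlonglongrightarrow> 0"
proof (rule LIMSEQ_I)
  fix r :: real assume r: "r > 0"
  \<comment> \<open>A positive bound on the weights, so that it can be divided by in \<open>\<tau>\<close>.\<close>
  define K' where "K' = max K 1"
  have K': "K' \<ge> 1" "K \<le> K'" by (auto simp: K'_def)
  \<comment> \<open>Half of the allowance \<open>r * \<eta>\<close> goes to the tails, the other half to the truncated part.\<close>
  define \<tau> where "\<tau> = r * \<eta> / (4 * K')"
  have \<tau>: "\<tau> > 0" using r \<eta> K' by (simp add: \<tau>_def)
  from tail[OF \<tau>] obtain L0 where L0: "\<And>N j. j \<in> {1..N} \<Longrightarrow>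
        (\<integral>x. (if \<bar>Z N j x\<bar> > L0 then \<bar>Z N j x\<bar> else 0) \<partial>M N) \<le> \<tau>" by blast
  define L where "L = max L0 0"
  have L: "L \<ge> 0" "L0 \<le> L" by (auto simp: L_def)
  have "(\<lambda>N. K' * L / sqrt (real N)) \<longlonglongrightarrow> 0"
    by (intro tendsto_divide_0[OF tendsto_const] filterlim_at_top_imp_at_infinity
        filterlim_compose[OF sqrt_at_top filterlim_real_sequentially])
  then have "eventually (\<lambda>N. K' * L / sqrt (real N) < r * \<eta> / 2) sequentially"
    using r \<eta> by (intro order_tendstoD(2)[where y=0]) auto
  with a eventually_ge_at_top[of 1]
  have "eventually (\<lambda>N. measure (M N) {x \<in> space (M N).
            \<bar>(\<Sum>j=1..N. a N j * (Z N j x - (\<integral>y. Z N j y \<partial>M N))) / real N\<bar> \<ge> \<eta>} < r) sequentially"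
  proof eventually_elim
    case (elim N)
    interpret prob_space "M N" by (rule prob) (use elim in simp)
    define S where "S x = (\<Sum>j=1..N. a N j * (Z N j x - expectation (Z N j)))" for x
    have int_S: "integrable (M N) S"
      unfolding S_def[abs_def]
      by (intro Bochner_Integration.integrable_sum integrable_mult_right
          Bochner_Integration.integrable_diff int) auto
    have tail': "expectation (\<lambda>x. if \<bar>Z N j x\<bar> > L then \<bar>Z N j x\<bar> else 0) \<le> \<tau>" if j: "j \<in> {1..N}" for j
    proof -
      have [measurable]: "Z N j \<in> borel_measurable (M N)" using int[OF j] by auto
      have *: "integrable (M N) (\<lambda>x. if \<bar>Z N j x\<bar> > c then \<bar>Z N j x\<bar> else 0)" for c
        by (rule Bochner_Integration.integrable_bound[OF int[OF j]]) auto
      have "expectation (\<lambda>x. if \<bar>Z N j x\<bar> > L then \<bar>Z N j x\<bar> else 0)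
          \<le> expectation (\<lambda>x. if \<bar>Z N j x\<bar> > L0 then \<bar>Z N j x\<bar> else 0)"
        by (intro integral_mono *) (use L in auto)
      with L0[OF j] show ?thesis by linarith
    qed
    have "expectation (\<lambda>x. \<bar>S x\<bar>)
        \<le> sqrt (real (card {1..N})) * (K' * L) + real (card {1..N}) * (2 * K' * \<tau>)"
      unfolding S_def
      by (intro expectation_abs_centered_sum_le_truncated ind int tail')
         (use elim K' L \<tau> in \<open>auto intro: order_trans\<close>)
    then have ES: "expectation (\<lambda>x. \<bar>S x\<bar>) \<le> sqrt (real N) * (K' * L) + real N * (2 * K' * \<tau>)"
      by simp
    have "measure (M N) {x \<in> space (M N). \<bar>S x / real N\<bar> \<ge> \<eta>}
        \<le> expectation (\<lambda>x. \<bar>S x / real N\<bar>) / \<eta>"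
      by (intro integral_Markov_inequality_measure[where A="{}"]) (use int_S \<eta> in auto)
    also have "expectation (\<lambda>x. \<bar>S x / real N\<bar>) = expectation (\<lambda>x. \<bar>S x\<bar>) / real N"
      by simp
    also have "\<dots> / \<eta> \<le> (sqrt (real N) * (K' * L) + real N * (2 * K' * \<tau>)) / real N / \<eta>"
      using ES \<eta> by (intro divide_right_mono) auto
    also have "\<dots> = (K' * L / sqrt (real N) + r * \<eta> / 2) / \<eta>"
    proof -
      have "sqrt (real N) / real N = 1 / sqrt (real N)"
        using elim by (simp add: real_div_sqrt field_simps)
      then have "sqrt (real N) * (K' * L) / real N = K' * L / sqrt (real N)"
        by (metis (no_types, lifting) mult.commute mult.right_neutral times_divide_eq_right)
      then show ?thesis
        using elim K' by (simp add: \<tau>_def add_divide_distrib)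
    qed
    also have "\<dots> < r"
      using elim \<eta> by (simp add: field_simps)
    finally show ?case by (simp add: S_def)
  qed
  then show "\<exists>N0. \<forall>N\<ge>N0. norm (measure (M N) {x \<in> space (M N).
            \<bar>(\<Sum>j=1..N. a N j * (Z N j x - (\<integral>y. Z N j y \<partial>M N))) / real N\<bar> \<ge> \<eta>} - 0) < r"
    by (simp add: eventually_sequentially)
qed

section \<open>Matrix inverses, determinants and linear systems\<close>

lemma matrix_inv_inverse:
  fixes A :: "real ^ 'n ^ 'n"
  assumes "invertible A"
  shows "A ** matrix_inv A = mat 1" "matrix_inv A ** A = mat 1"
  using someI_ex[OF assms[unfolded invertible_def]] unfolding matrix_inv_def by blast+

lemma abs_det_le_fact:
  fixes A :: "real ^ 'n ^ 'n"
  assumes "\<And>i j. \<bar>A $ i $ j\<bar> \<le> 1"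
  shows "\<bar>det A\<bar> \<le> fact CARD('n)"
proof -
  have "\<bar>det A\<bar> \<le> (\<Sum>\<pi> | \<pi> permutes (UNIV :: 'n set). \<bar>of_int (sign \<pi>) * (\<Prod>i\<in>UNIV. A $ i $ \<pi> i)\<bar>)"
    unfolding det_def by (rule sum_abs)
  also have "\<dots> \<le> (\<Sum>\<pi> | \<pi> permutes (UNIV :: 'n set). 1)"
  proof (rule sum_mono)
    fix \<pi> :: "'n \<Rightarrow> 'n"
    have "\<bar>\<Prod>i\<in>UNIV. A $ i $ \<pi> i\<bar> \<le> 1"
      unfolding abs_prod by (rule prod_le_1) (use assms in auto)
    then show "\<bar>of_int (sign \<pi>) * (\<Prod>i\<in>UNIV. A $ i $ \<pi> i)\<bar> \<le> 1"
      by (simp add: abs_mult sign_def)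
  qed
  also have "\<dots> = fact CARD('n)"
    by (simp add: card_permutations[OF refl])
  finally show ?thesis .
qed

text \<open>
  Cramer's rule writes the solution of a linear system as a quotient of polynomials in the matrix
  and the right-hand side, whose denominator does not vanish near an invertible matrix. The
  neighbourhood is described entrywise because the laws of large numbers below are scalar.
\<close>

lemma continuous_linear_solution:
  fixes A :: "real ^ 'n ^ 'n" and x :: "real ^ 'n"
  assumes "invertible A" "\<delta> > 0"
  obtains \<eta> where "\<eta> > 0"
    "\<And>A' h x'. (\<And>i l. \<bar>A' $ i $ l - A $ i $ l\<bar> < \<eta>) \<Longrightarrow>
       (\<And>i. \<bar>h $ i - (A *v x) $ i\<bar> < \<eta>) \<Longrightarrow>
       invertible A' \<and> (A' *v x' = h \<longrightarrow> dist x' x < \<delta>)"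
proof -
  let ?F = "nhds (A, A *v x)"
  \<comment> \<open>The solution of the system with matrix \<open>A\<close> and right-hand side \<open>h\<close>, by Cramer's rule.\<close>
  define cr :: "(real ^ 'n ^ 'n) \<times> (real ^ 'n) \<Rightarrow> real ^ 'n"
    where "cr = (\<lambda>(A, h). \<chi> k. det (\<chi> i j. if j = k then h $ i else A $ i $ j) / det A)"
  have lim: "((\<lambda>z. fst z $ i $ j) \<longlongrightarrow> A $ i $ j) ?F" "((\<lambda>z. snd z $ i) \<longlongrightarrow> (A *v x) $ i) ?F" for i j
    using tendsto_fst[OF filterlim_ident[of ?F]] tendsto_snd[OF filterlim_ident[of ?F]]
    by (auto intro!: tendsto_vec_nth)
  have det: "((\<lambda>z. det (B z)) \<longlongrightarrow> det B0) ?F"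
    if "\<And>i j. ((\<lambda>z. B z $ i $ j) \<longlongrightarrow> B0 $ i $ j) ?F" for B and B0 :: "real ^ 'n ^ 'n"
    unfolding det_def by (intro tendsto_intros that)
  have A0: "det A \<noteq> 0"
    using assms(1) by (simp add: invertible_det_nz)
  have "(cr \<longlongrightarrow> cr (A, A *v x)) ?F"
    unfolding cr_def case_prod_beta fst_conv snd_conv
    by (intro tendsto_vec_lambda tendsto_divide det A0) (auto intro: lim)
  moreover have "cr (A, A *v x) = x"
    using cramer[OF A0, of x "A *v x"] by (simp add: cr_def)
  ultimately have "eventually (\<lambda>z. dist (cr z) x < \<delta>) ?F"
    using assms(2) by (simp add: tendstoD)
  moreover have "eventually (\<lambda>z. det (fst z) \<noteq> 0) ?F"
    using tendsto_imp_eventually_ne[OF det A0] lim by blast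
  ultimately have "eventually (\<lambda>z. det (fst z) \<noteq> 0 \<and> dist (cr z) x < \<delta>) ?F"
    by eventually_elim auto
  then obtain e where e: "e > 0"
    "\<And>z. dist z (A, A *v x) < e \<Longrightarrow> det (fst z) \<noteq> 0 \<and> dist (cr z) x < \<delta>"
    unfolding eventually_nhds_metric by blast
  \<comment> \<open>The \<open>n * n\<close> entries of the matrix and the \<open>n\<close> entries of the right-hand side share the radius \<open>e\<close>.\<close>
  define n where "n = real CARD('n)"
  define \<eta> where "\<eta> = e / (n * n + n)"
  have n: "n > 0" by (simp add: n_def)
  have \<eta>: "\<eta> > 0" using e(1) n by (simp add: \<eta>_def add_pos_pos)
  show ?thesis
  proof (rule that[OF \<eta>])
    fix A' :: "real ^ 'n ^ 'n" and h x' :: "real ^ 'n"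
    assume AA: "\<And>i l. \<bar>A' $ i $ l - A $ i $ l\<bar> < \<eta>" and hh: "\<And>i. \<bar>h $ i - (A *v x) $ i\<bar> < \<eta>"
    have row: "norm ((A' - A) $ i) < n * \<eta>" for i
    proof -
      have "norm ((A' - A) $ i) \<le> (\<Sum>l\<in>UNIV. \<bar>(A' - A) $ i $ l\<bar>)" by (rule norm_le_l1_cart)
      also have "\<dots> < (\<Sum>l\<in>(UNIV::'n set). \<eta>)" by (intro sum_strict_mono) (use AA in auto)
      finally show ?thesis by (simp add: n_def)
    qed
    have "norm (A' - A) \<le> (\<Sum>i\<in>UNIV. norm ((A' - A) $ i))"
      unfolding norm_vec_def by (rule L2_set_le_sum) simp
    also have "\<dots> < (\<Sum>i\<in>(UNIV::'n set). n * \<eta>)" by (intro sum_strict_mono row) auto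
    finally have 1: "norm (A' - A) < n * n * \<eta>" by (simp add: n_def)
    have "norm (h - A *v x) \<le> (\<Sum>i\<in>UNIV. \<bar>(h - A *v x) $ i\<bar>)" by (rule norm_le_l1_cart)
    also have "\<dots> < (\<Sum>i\<in>(UNIV::'n set). \<eta>)" by (intro sum_strict_mono) (use hh in auto)
    finally have 2: "norm (h - A *v x) < n * \<eta>" by (simp add: n_def)
    have "dist (A', h) (A, A *v x) \<le> norm (A' - A) + norm (h - A *v x)"
      by (simp add: dist_norm norm_Pair_le)
    also have "\<dots> < n * n * \<eta> + n * \<eta>" using 1 2 by simp
    also have "\<dots> = (n * n + n) * \<eta>" by (simp add: algebra_simps)
    also have "\<dots> = e" using n by (simp add: \<eta>_def add_pos_pos less_imp_neq[symmetric])
    finally have "det A' \<noteq> 0" "dist (cr (A', h)) x < \<delta>"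
      using e(2)[of "(A', h)"] by auto
    then show "invertible A' \<and> (A' *v x' = h \<longrightarrow> dist x' x < \<delta>)"
      using cramer[of A' x' h] by (auto simp: invertible_det_nz cr_def)
  qed
qed

section \<open>The minimax weights\<close>

text \<open>
  The weight of subject \<open>j\<close> is the \<open>m\<close>-th coordinate of the solution \<open>x\<close> of
  \<open>conc_gram p N *v x = p N j\<close>. In Cramer's formula for it the numerator is the determinant of a
  matrix with entries in \<open>[-1, 1]\<close>, and the denominator exceeds \<open>C\<close>.
\<close>

lemma abs_minimax_weight_le:
  fixes p :: "nat \<Rightarrow> nat \<Rightarrow> real ^ 'k"
  assumes p: "\<And>j k. j \<in> {1..N} \<Longrightarrow> 0 \<le> p N j $ k \<and> p N j $ k \<le> 1"
    and det: "det (conc_gram p N) > C" and C: "C > 0" and j: "j \<in> {1..N}"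
  shows "\<bar>minimax_weight p m N j\<bar> \<le> fact CARD('k) / C"
proof -
  let ?\<Gamma> = "conc_gram p N"
  have inv: "invertible ?\<Gamma>" using det C by (simp add: invertible_det_nz)
  define x where "x = matrix_inv ?\<Gamma> *v p N j"
  have x: "x $ m = minimax_weight p m N j"
    by (simp add: x_def minimax_weight_def matrix_vector_mult_def)
  have "?\<Gamma> *v x = p N j"
    by (simp add: x_def matrix_vector_mul_assoc matrix_inv_inverse[OF inv])
  moreover have "det ?\<Gamma> \<noteq> 0" using det C by simp
  ultimately have "x = (\<chi> k. det (\<chi> i l. if l = k then p N j $ i else ?\<Gamma> $ i $ l) / det ?\<Gamma>)"
    using cramer by blast
  from arg_cong[OF this, of "\<lambda>z. z $ m"]
  have eq: "x $ m = det (\<chi> i l. if l = m then p N j $ i else ?\<Gamma> $ i $ l) / det ?\<Gamma>"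
    by simp
  have entry: "\<bar>?\<Gamma> $ i $ l\<bar> \<le> 1" for i l
  proof -
    have "\<bar>\<Sum>j=1..N. p N j $ i * p N j $ l\<bar> \<le> (\<Sum>j=1..N. 1)"
      by (rule order_trans[OF sum_abs sum_mono]) (use p in \<open>auto simp: abs_mult intro!: mult_le_one\<close>)
    then have "\<bar>\<Sum>j=1..N. p N j $ i * p N j $ l\<bar> / real N \<le> 1"
      using j by (simp add: divide_le_eq_1)
    then show ?thesis by (simp add: conc_gram_def abs_mult)
  qed
  have "\<bar>x $ m\<bar> \<le> fact CARD('k) / det ?\<Gamma>"
    unfolding eq using det C
    by (simp only: abs_divide, intro frac_le abs_det_le_fact) (use p[OF j] entry in auto)
  also have "\<dots> \<le> fact CARD('k) / C"
    using det C by (intro divide_left_mono) auto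
  finally show ?thesis by (simp add: x)
qed

text \<open>
  This is why the weighted averages single out component \<open>m\<close>: the averages of
  \<open>minimax_weight p m N j * p N j $ k\<close> are the entries in row \<open>m\<close> of the inverse of the Gram matrix
  multiplied by the Gram matrix itself.
\<close>

lemma minimax_weight_biorthogonal:
  fixes p :: "nat \<Rightarrow> nat \<Rightarrow> real ^ 'k"
  assumes "invertible (conc_gram p N)"
  shows "(\<Sum>j=1..N. minimax_weight p m N j * p N j $ k) / real N = (if k = m then 1 else 0)"
proof -
  let ?G = "matrix_inv (conc_gram p N)"
  have "(\<Sum>j=1..N. minimax_weight p m N j * p N j $ k) / real N
      = (\<Sum>l\<in>UNIV. ?G $ m $ l * ((1 / real N) * (\<Sum>j=1..N. p N j $ l * p N j $ k)))"
    unfolding minimax_weight_def sum_distrib_right sum_distrib_left sum_divide_distrib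
    by (subst sum.swap) (simp add: mult_ac)
  also have "\<dots> = (?G ** conc_gram p N) $ m $ k"
    by (simp add: matrix_matrix_mult_def conc_gram_def)
  also have "\<dots> = (if k = m then 1 else 0)"
    using matrix_inv_inverse(2)[OF assms] by (simp add: mat_def)
  finally show ?thesis .
qed

section \<open>Integrals over product measures and tails\<close>

lemma product_integral:
  fixes f :: "'a \<Rightarrow> real" and g :: "'b \<Rightarrow> real"
  assumes "prob_space M1" "prob_space M2" and f: "integrable M1 f" and g: "integrable M2 g"
  shows "integrable (M1 \<Otimes>\<^sub>M M2) (\<lambda>(x, y). f x * g y)"
    and "(\<integral>(x, y). f x * g y \<partial>(M1 \<Otimes>\<^sub>M M2)) = (\<integral>x. f x \<partial>M1) * (\<integral>y. g y \<partial>M2)"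
proof -
  interpret M1: prob_space M1 by fact
  interpret M2: prob_space M2 by fact
  interpret pair_sigma_finite M1 M2 ..
  have [measurable]: "f \<in> borel_measurable M1" "g \<in> borel_measurable M2" using f g by auto
  show int: "integrable (M1 \<Otimes>\<^sub>M M2) (\<lambda>(x, y). f x * g y)"
    by (rule Fubini_integrable) (use f g in \<open>auto simp: abs_mult\<close>)
  show "(\<integral>(x, y). f x * g y \<partial>(M1 \<Otimes>\<^sub>M M2)) = (\<integral>x. f x \<partial>M1) * (\<integral>y. g y \<partial>M2)"
    using integral_fst'[OF int] by simp
qed

lemma finite_family_tail_integral:
  fixes M :: "'k::finite \<Rightarrow> 'a measure" and h :: "'a \<Rightarrow> real"
  assumes h: "\<And>k. integrable (M k) h" and \<tau>: "\<tau> > 0"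
  shows "\<exists>L. \<forall>k. (\<integral>z. (if \<bar>h z\<bar> > L then \<bar>h z\<bar> else 0) \<partial>M k) \<le> \<tau>"
proof -
  have "eventually (\<lambda>n. (\<integral>z. (if \<bar>h z\<bar> > real n then \<bar>h z\<bar> else 0) \<partial>M k) < \<tau>) sequentially" for k
  proof (rule order_tendstoD(2)[OF _ \<tau>])
    have [measurable]: "h \<in> borel_measurable (M k)" using h[of k] by auto
    have "(\<lambda>n. \<integral>z. (if \<bar>h z\<bar> > real n then \<bar>h z\<bar> else 0) \<partial>M k) \<longlonglongrightarrow> (\<integral>z. 0 \<partial>M k)"
    proof (rule integral_dominated_convergence[where w="\<lambda>z. \<bar>h z\<bar>"])
      show "AE z in M k. (\<lambda>n. if \<bar>h z\<bar> > real n then \<bar>h z\<bar> else 0) \<longlonglongrightarrow> 0"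
      proof (rule AE_I2, rule tendsto_eventually)
        fix z
        have "eventually (\<lambda>n. real n \<ge> \<bar>h z\<bar>) sequentially"
          using filterlim_real_sequentially by (simp add: filterlim_at_top)
        then show "eventually (\<lambda>n. (if \<bar>h z\<bar> > real n then \<bar>h z\<bar> else 0) = 0) sequentially"
          by eventually_elim auto
      qed
    qed (use h[of k] in auto)
    then show "(\<lambda>n. \<integral>z. (if \<bar>h z\<bar> > real n then \<bar>h z\<bar> else 0) \<partial>M k) \<longlonglongrightarrow> 0" by simp
  qed
  then have "eventually (\<lambda>n. \<forall>k. (\<integral>z. (if \<bar>h z\<bar> > real n then \<bar>h z\<bar> else 0) \<partial>M k) < \<tau>) sequentially"
    by (simp add: eventually_all_finite)
  then show ?thesis
    by (auto simp: eventually_sequentially intro: less_imp_le)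
qed

section \<open>Observations from the mixture\<close>

text \<open>
  The law of a response \<open>\<beta> \<bullet> x + e\<close> together with its regressors \<open>x\<close>, when \<open>x\<close> and the error
  \<open>e\<close> are independent with laws \<open>F\<close> and \<open>G\<close>.
\<close>

definition component_law ::
    "real ^ 'd \<Rightarrow> (real ^ 'd) measure \<Rightarrow> real measure \<Rightarrow> (real \<times> (real ^ 'd)) measure" where
  "component_law \<beta> F G = distr (F \<Otimes>\<^sub>M G) (borel \<Otimes>\<^sub>M borel) (\<lambda>(x, e). (\<beta> \<bullet> x + e, x))"

lemma inner_sum_mult: "(x :: real ^ 'd) \<bullet> y = (\<Sum>i\<in>UNIV. x $ i * y $ i)"
  by (simp add: inner_vec_def)

context mixture_regression
begin

abbreviation obs_law :: "'k \<Rightarrow> (real \<times> (real ^ 'd)) measure" where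
  "obs_law k \<equiv> component_law (b k) (FX k) (Fe k)"

lemma sets_obs_law: "sets (obs_law k) = sets (borel \<Otimes>\<^sub>M borel)"
  by (simp add: component_law_def)

lemma measurable_response_map:
  "(\<lambda>(x, e). (\<beta> \<bullet> x + e, x)) \<in> measurable (FX k \<Otimes>\<^sub>M Fe k) (borel \<Otimes>\<^sub>M (borel :: (real ^ 'd) measure))"
proof -
  have "(\<lambda>(x :: real ^ 'd, e). (\<beta> \<bullet> x + e, x)) \<in> measurable (borel \<Otimes>\<^sub>M borel) (borel \<Otimes>\<^sub>M borel)"
    by measurable
  moreover have "sets (FX k \<Otimes>\<^sub>M Fe k) = sets (borel \<Otimes>\<^sub>M borel)"
    by (intro sets_pair_measure_cong sets_FX sets_Fe)
  ultimately show ?thesis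
    using measurable_cong_sets by blast
qed

lemma prob_space_obs_law: "prob_space (obs_law k)"
proof -
  interpret FX: prob_space "FX k" by (rule prob_space_FX)
  interpret Fe: prob_space "Fe k" by (rule prob_space_Fe)
  interpret pair_prob_space "FX k" "Fe k" ..
  show ?thesis unfolding component_law_def
    by (rule prob_space_distr[OF measurable_response_map])
qed

lemma measurable_observation:
  assumes "j \<in> {1..N}"
  shows "\<kappa> N j \<in> measurable (P N) (count_space UNIV)" "Y N j \<in> borel_measurable (P N)"
    "X N j \<in> borel_measurable (P N)" "\<epsilon> N j \<in> borel_measurable (P N)"
    "(\<lambda>\<omega>. X N j \<omega> $ i) \<in> borel_measurable (P N)"
proof -
  have N: "N \<ge> 1" using assms by simp
  have *: "(\<lambda>\<omega>. (\<kappa> N j \<omega>, (Y N j \<omega>, X N j \<omega>)))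
      \<in> measurable (P N) (count_space UNIV \<Otimes>\<^sub>M (borel \<Otimes>\<^sub>M borel))"
    using independent[OF N] assms by (auto simp: prob_space.indep_vars_def[OF prob_space_P[OF N]])
  show \<kappa>[measurable]: "\<kappa> N j \<in> measurable (P N) (count_space UNIV)"
    using measurable_compose[OF * measurable_fst] by simp
  show [measurable]: "Y N j \<in> borel_measurable (P N)"
    using measurable_compose[OF measurable_compose[OF * measurable_snd] measurable_fst] by simp
  show X: "X N j \<in> borel_measurable (P N)"
    using measurable_compose[OF measurable_compose[OF * measurable_snd] measurable_snd] by simp
  have Xi[measurable]: "(\<lambda>\<omega>. X N j \<omega> $ i) \<in> borel_measurable (P N)" for i
    by (rule measurable_compose[OF X]) simp
  show "(\<lambda>\<omega>. X N j \<omega> $ i) \<in> borel_measurable (P N)" by (rule Xi)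
  have [measurable]: "(\<lambda>\<omega>. b (\<kappa> N j \<omega>) $ i) \<in> borel_measurable (P N)" for i
    by (rule measurable_compose[OF \<kappa>]) simp
  have "(\<lambda>\<omega>. Y N j \<omega> - (\<Sum>i\<in>UNIV. b (\<kappa> N j \<omega>) $ i * X N j \<omega> $ i)) \<in> borel_measurable (P N)"
    by measurable
  then show "\<epsilon> N j \<in> borel_measurable (P N)"
    by (rule measurable_cong[THEN iffD1, rotated]) (use regression[OF assms] in simp)
qed

lemma observation_law_given_component:
  assumes j: "j \<in> {1..N}" and pos: "p N j $ k > 0"
  shows "distr (uniform_measure (P N) {\<omega> \<in> space (P N). \<kappa> N j \<omega> = k}) (borel \<Otimes>\<^sub>M borel)
           (\<lambda>\<omega>. (Y N j \<omega>, X N j \<omega>)) = obs_law k"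
proof -
  note [measurable] = measurable_observation[OF j]
  let ?A = "{\<omega> \<in> space (P N). \<kappa> N j \<omega> = k}"
  let ?Q = "uniform_measure (P N) ?A"
  have A: "?A \<in> sets (P N)" by measurable
  have "obs_law k = distr (distr ?Q (borel \<Otimes>\<^sub>M borel) (\<lambda>\<omega>. (X N j \<omega>, \<epsilon> N j \<omega>))) (borel \<Otimes>\<^sub>M borel)
      (\<lambda>(x, e). (b k \<bullet> x + e, x))"
    by (simp add: component_law_def law_given_component[OF j pos])
  also have "\<dots> = distr ?Q (borel \<Otimes>\<^sub>M borel) (\<lambda>\<omega>. (b k \<bullet> X N j \<omega> + \<epsilon> N j \<omega>, X N j \<omega>))"
    by (subst distr_distr) (auto simp: comp_def)
  also have "\<dots> = distr ?Q (borel \<Otimes>\<^sub>M borel) (\<lambda>\<omega>. (Y N j \<omega>, X N j \<omega>))"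
  proof (rule distr_cong_AE)
    show "AE \<omega> in ?Q. (b k \<bullet> X N j \<omega> + \<epsilon> N j \<omega>, X N j \<omega>) = (Y N j \<omega>, X N j \<omega>)"
      by (rule AE_uniform_measureI[OF A], rule AE_I2)
         (use regression[OF j] in \<open>auto simp: inner_sum_mult\<close>)
  qed auto
  finally show ?thesis by simp
qed

text \<open>
  When component \<open>k\<close> has positive probability, the conditional law is the density
  \<open>indicator A / p N j $ k\<close> with respect to \<open>P N\<close>, with \<open>A\<close> the event that \<open>j\<close> belongs to
  component \<open>k\<close>. When its probability is zero, nothing is known about the conditional law, but both
  sides vanish.
\<close>

lemma integral_on_component:
  fixes h :: "real \<times> (real ^ 'd) \<Rightarrow> real"
  assumes j: "j \<in> {1..N}" and int: "integrable (obs_law k) h"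
  shows "integrable (P N) (\<lambda>\<omega>. indicator {\<omega> \<in> space (P N). \<kappa> N j \<omega> = k} \<omega> * h (Y N j \<omega>, X N j \<omega>))"
      (is "integrable _ ?f")
    and "(\<integral>\<omega>. indicator {\<omega> \<in> space (P N). \<kappa> N j \<omega> = k} \<omega> * h (Y N j \<omega>, X N j \<omega>) \<partial>P N)
           = p N j $ k * (\<integral>z. h z \<partial>obs_law k)"
proof -
  interpret prob_space "P N" by (rule prob_space_P) (use j in simp)
  note [measurable] = measurable_observation[OF j]
  have h[measurable]: "h \<in> borel_measurable (borel \<Otimes>\<^sub>M borel)"
    using borel_measurable_integrable[OF int] measurable_cong_sets[OF sets_obs_law refl] by blast
  let ?A = "{\<omega> \<in> space (P N). \<kappa> N j \<omega> = k}"
  have A[measurable]: "?A \<in> sets (P N)" by measurable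
  have pA: "prob ?A = p N j $ k" by (rule prob_component[OF j])
  have "integrable (P N) ?f \<and> (\<integral>\<omega>. ?f \<omega> \<partial>P N) = p N j $ k * (\<integral>z. h z \<partial>obs_law k)"
  proof (cases "p N j $ k > 0")
    case False
    then have 0: "p N j $ k = 0" using pA measure_nonneg[of "P N" ?A] by simp
    then have "AE \<omega> in P N. \<omega> \<notin> ?A"
      using pA prob_eq_0[OF A] by simp
    then have ae: "AE \<omega> in P N. ?f \<omega> = 0" by eventually_elim simp
    have "integrable (P N) ?f"
      by (subst integrable_cong_AE[OF _ _ ae]) auto
    moreover have "(\<integral>\<omega>. ?f \<omega> \<partial>P N) = 0"
      by (subst integral_cong_AE[OF _ _ ae]) auto
    ultimately show ?thesis using 0 by simp
  next
    case True
    let ?g = "\<lambda>\<omega>. indicator ?A \<omega> / p N j $ k"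
    let ?H = "\<lambda>\<omega>. h (Y N j \<omega>, X N j \<omega>)"
    have Q: "uniform_measure (P N) ?A = density (P N) (\<lambda>\<omega>. ennreal (?g \<omega>))"
      unfolding uniform_measure_def
      by (rule density_cong)
         (use True in \<open>auto simp: emeasure_eq_measure pA indicator_def divide_ennreal simp flip: ennreal_1\<close>)
    have law: "distr (density (P N) (\<lambda>\<omega>. ennreal (?g \<omega>))) (borel \<Otimes>\<^sub>M borel)
        (\<lambda>\<omega>. (Y N j \<omega>, X N j \<omega>)) = obs_law k"
      using observation_law_given_component[OF j True] by (simp add: Q)
    have "integrable (density (P N) (\<lambda>\<omega>. ennreal (?g \<omega>))) ?H"
      using int unfolding law[symmetric] by (subst (asm) integrable_distr_eq) auto
    then have i: "integrable (P N) (\<lambda>\<omega>. ?g \<omega> * ?H \<omega>)"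
      using True by (subst (asm) integrable_real_density) auto
    have "(\<integral>z. h z \<partial>obs_law k) = (\<integral>\<omega>. ?H \<omega> \<partial>density (P N) (\<lambda>\<omega>. ennreal (?g \<omega>)))"
      unfolding law[symmetric] by (subst integral_distr) auto
    also have "\<dots> = (\<integral>\<omega>. ?g \<omega> * ?H \<omega> \<partial>P N)"
      using True by (subst integral_real_density) auto
    finally have e: "(\<integral>z. h z \<partial>obs_law k) = (\<integral>\<omega>. ?g \<omega> * ?H \<omega> \<partial>P N)" .
    have f: "?f = (\<lambda>\<omega>. p N j $ k * (?g \<omega> * ?H \<omega>))"
      using True by (auto simp: fun_eq_iff)
    have "integrable (P N) ?f" unfolding f by (intro integrable_mult_right i)
    moreover have "(\<integral>\<omega>. ?f \<omega> \<partial>P N) = p N j $ k * (\<integral>z. h z \<partial>obs_law k)"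
      unfolding f e by (rule Bochner_Integration.integral_mult_right_zero)
    ultimately show ?thesis ..
  qed
  then show "integrable (P N) ?f" "(\<integral>\<omega>. ?f \<omega> \<partial>P N) = p N j $ k * (\<integral>z. h z \<partial>obs_law k)"
    by auto
qed

lemma expectation_observation:
  fixes h :: "real \<times> (real ^ 'd) \<Rightarrow> real"
  assumes j: "j \<in> {1..N}" and int: "\<And>k. integrable (obs_law k) h"
  shows "integrable (P N) (\<lambda>\<omega>. h (Y N j \<omega>, X N j \<omega>))"
    and "(\<integral>\<omega>. h (Y N j \<omega>, X N j \<omega>) \<partial>P N) = (\<Sum>k\<in>UNIV. p N j $ k * (\<integral>z. h z \<partial>obs_law k))"
proof -
  let ?f = "\<lambda>k \<omega>. indicator {\<omega> \<in> space (P N). \<kappa> N j \<omega> = k} \<omega> * h (Y N j \<omega>, X N j \<omega>)"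
  have eq: "h (Y N j \<omega>, X N j \<omega>) = (\<Sum>k\<in>UNIV. ?f k \<omega>)" if "\<omega> \<in> space (P N)" for \<omega>
  proof -
    have "(\<Sum>k\<in>UNIV. ?f k \<omega>) = (\<Sum>k\<in>UNIV. if k = \<kappa> N j \<omega> then h (Y N j \<omega>, X N j \<omega>) else 0)"
      using that by (intro sum.cong) auto
    then show ?thesis by simp
  qed
  note on = integral_on_component[OF j int]
  show "integrable (P N) (\<lambda>\<omega>. h (Y N j \<omega>, X N j \<omega>))"
    by (rule Bochner_Integration.integrable_cong[OF refl eq, THEN iffD2])
       (assumption, intro Bochner_Integration.integrable_sum on)
  have "(\<integral>\<omega>. h (Y N j \<omega>, X N j \<omega>) \<partial>P N) = (\<integral>\<omega>. (\<Sum>k\<in>UNIV. ?f k \<omega>) \<partial>P N)"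
    by (rule Bochner_Integration.integral_cong[OF refl eq])
  also have "\<dots> = (\<Sum>k\<in>UNIV. p N j $ k * (\<integral>z. h z \<partial>obs_law k))"
    by (subst Bochner_Integration.integral_sum) (rule on(1) sum.cong[OF refl on(2)])+
  finally show "(\<integral>\<omega>. h (Y N j \<omega>, X N j \<omega>) \<partial>P N) = (\<Sum>k\<in>UNIV. p N j $ k * (\<integral>z. h z \<partial>obs_law k))" .
qed

lemma concentration_bounds:
  assumes "j \<in> {1..N}"
  shows "0 \<le> p N j $ k" "p N j $ k \<le> 1" "(\<Sum>k\<in>UNIV. p N j $ k) = 1"
proof -
  interpret prob_space "P N" by (rule prob_space_P) (use assms in simp)
  show "0 \<le> p N j $ k" "p N j $ k \<le> 1"
    unfolding prob_component[OF assms, symmetric] by (auto intro: prob_le_1)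
  \<comment> \<open>Integrating the constant function 1 component by component shows that the concentrations
    sum to one.\<close>
  have "(\<integral>z. (1 :: real) \<partial>obs_law k) = 1" "integrable (obs_law k) (\<lambda>z. 1 :: real)" for k
    using prob_space_obs_law[of k]
    by (auto simp: prob_space.prob_space intro!: finite_measure.integrable_const prob_space.finite_measure)
  then show "(\<Sum>k\<in>UNIV. p N j $ k) = 1"
    using expectation_observation(2)[OF assms, of "\<lambda>_. 1"] by (simp add: prob_space)
qed

text \<open>
  The weighted mean of \<open>h\<close> estimates its mean in component \<open>m\<close> alone. The subjects have only
  finitely many component laws, mixed with the concentrations, so that the array is uniformly
  integrable and the weak law applies; biorthogonality makes the expectation of the
  weighted mean equal to the mean of \<open>h\<close> in component \<open>m\<close>.
\<close>

lemma weighted_mean_tendsto_in_probability: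
  fixes h :: "real \<times> (real ^ 'd) \<Rightarrow> real"
  assumes int: "\<And>k. integrable (obs_law k) h"
    and det: "C > 0" "eventually (\<lambda>N. det (conc_gram p N) > C) sequentially" and \<eta>: "\<eta> > 0"
  shows "(\<lambda>N. measure (P N) {\<omega> \<in> space (P N).
            \<bar>(\<Sum>j=1..N. minimax_weight p m N j * h (Y N j \<omega>, X N j \<omega>)) / real N
              - (\<integral>z. h z \<partial>obs_law m)\<bar> \<ge> \<eta>}) \<longlonglongrightarrow> 0"
proof -
  let ?Z = "\<lambda>N j \<omega>. h (Y N j \<omega>, X N j \<omega>)" and ?a = "minimax_weight p m"
  have h[measurable]: "h \<in> borel_measurable (borel \<Otimes>\<^sub>M borel)"
    using borel_measurable_integrable[OF int] measurable_cong_sets[OF sets_obs_law refl] by blast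
  have ind: "prob_space.indep_vars (P N) (\<lambda>_. borel) (?Z N) {1..N}" if "N \<ge> 1" for N
    using prob_space.indep_vars_compose2[OF prob_space_P[OF that] independent[OF that],
        of "\<lambda>j z. h (snd z)" "\<lambda>_. borel"] by simp
  have tail: "\<exists>L. \<forall>N. \<forall>j\<in>{1..N}. (\<integral>\<omega>. (if \<bar>?Z N j \<omega>\<bar> > L then \<bar>?Z N j \<omega>\<bar> else 0) \<partial>P N) \<le> \<tau>"
    if "\<tau> > 0" for \<tau>
  proof -
    from finite_family_tail_integral[of obs_law h, OF int that] obtain L
      where L: "\<And>k. (\<integral>z. (if \<bar>h z\<bar> > L then \<bar>h z\<bar> else 0) \<partial>obs_law k) \<le> \<tau>" by blast
    have i: "integrable (obs_law k) (\<lambda>z. if \<bar>h z\<bar> > L then \<bar>h z\<bar> else 0)" for k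
    proof -
      have [measurable]: "h \<in> borel_measurable (obs_law k)" using int[of k] by auto
      show ?thesis by (rule Bochner_Integration.integrable_bound[OF int[of k]]) auto
    qed
    have "(\<integral>\<omega>. (if \<bar>?Z N j \<omega>\<bar> > L then \<bar>?Z N j \<omega>\<bar> else 0) \<partial>P N) \<le> \<tau>" if j: "j \<in> {1..N}" for N j
    proof -
      have "(\<integral>\<omega>. (if \<bar>?Z N j \<omega>\<bar> > L then \<bar>?Z N j \<omega>\<bar> else 0) \<partial>P N)
          = (\<Sum>k\<in>UNIV. p N j $ k * (\<integral>z. (if \<bar>h z\<bar> > L then \<bar>h z\<bar> else 0) \<partial>obs_law k))"
        by (rule expectation_observation(2)[OF j i])
      also have "\<dots> \<le> (\<Sum>k\<in>UNIV. p N j $ k * \<tau>)"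
        by (intro sum_mono mult_left_mono L concentration_bounds[OF j])
      also have "\<dots> = \<tau>"
        using concentration_bounds(3)[OF j] by (simp flip: sum_distrib_right)
      finally show ?thesis .
    qed
    then show ?thesis by blast
  qed
  have weights: "eventually (\<lambda>N. \<forall>j\<in>{1..N}. \<bar>?a N j\<bar> \<le> fact CARD('k) / C) sequentially"
    using det(2) by eventually_elim
      (use det(1) concentration_bounds in \<open>auto intro!: abs_minimax_weight_le\<close>)
  have lim: "(\<lambda>N. measure (P N) {\<omega> \<in> space (P N).
      \<bar>(\<Sum>j=1..N. ?a N j * (?Z N j \<omega> - (\<integral>\<omega>. ?Z N j \<omega> \<partial>P N))) / real N\<bar> \<ge> \<eta>}) \<longlonglongrightarrow> 0"
    by (rule weak_law_weighted_triangular_array[OF prob_space_P ind expectation_observation(1)[OF _ int]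
          tail weights \<eta>])
  have "eventually (\<lambda>N. \<forall>\<omega>. (\<Sum>j=1..N. ?a N j * (?Z N j \<omega> - (\<integral>\<omega>. ?Z N j \<omega> \<partial>P N))) / real N
      = (\<Sum>j=1..N. ?a N j * ?Z N j \<omega>) / real N - (\<integral>z. h z \<partial>obs_law m)) sequentially"
    using det(2)
  proof eventually_elim
    case (elim N)
    then have inv: "invertible (conc_gram p N)" using det(1) by (simp add: invertible_det_nz)
    have "(\<Sum>j=1..N. ?a N j * (\<integral>\<omega>. ?Z N j \<omega> \<partial>P N)) / real N
        = (\<Sum>j=1..N. \<Sum>k\<in>UNIV. ?a N j * p N j $ k * (\<integral>z. h z \<partial>obs_law k)) / real N"
      using expectation_observation(2)[OF _ int] by (simp add: sum_distrib_left mult.assoc)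
    also have "\<dots> = (\<Sum>k\<in>UNIV. (\<Sum>j=1..N. ?a N j * p N j $ k) / real N * (\<integral>z. h z \<partial>obs_law k))"
      by (subst sum.swap) (simp add: sum_divide_distrib sum_distrib_right)
    also have "\<dots> = (\<Sum>k\<in>UNIV. if k = m then (\<integral>z. h z \<partial>obs_law k) else 0)"
      unfolding minimax_weight_biorthogonal[OF inv] by (intro sum.cong) auto
    also have "\<dots> = (\<integral>z. h z \<partial>obs_law m)"
      by simp
    finally show ?case
      by (simp add: right_diff_distrib sum_subtractf diff_divide_distrib)
  qed
  then have "eventually (\<lambda>N. measure (P N) {\<omega> \<in> space (P N).
      \<bar>(\<Sum>j=1..N. ?a N j * (?Z N j \<omega> - (\<integral>\<omega>. ?Z N j \<omega> \<partial>P N))) / real N\<bar> \<ge> \<eta>}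
    = measure (P N) {\<omega> \<in> space (P N).
      \<bar>(\<Sum>j=1..N. ?a N j * ?Z N j \<omega>) / real N - (\<integral>z. h z \<partial>obs_law m)\<bar> \<ge> \<eta>}) sequentially"
    by eventually_elim simp
  with lim show ?thesis
    by (simp add: tendsto_cong)
qed

text \<open>
  The mixed moment of a regressor and the response has no contribution of the error, which is
  centred and independent of the regressors. Hence \<open>b k\<close> solves the normal equations of component
  \<open>k\<close>, whose matrix and right-hand side are the moments given here.
\<close>

lemma second_moments_of_observation:
  assumes sq: "\<And>i l. integrable (FX k) (\<lambda>x. x $ i * x $ l)"
  shows "integrable (obs_law k) (\<lambda>(y, x). x $ i * x $ l)"
    and "(\<integral>(y, x). x $ i * x $ l \<partial>obs_law k) = second_moment_matrix (FX k) $ i $ l"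
    and "integrable (obs_law k) (\<lambda>(y, x). x $ i * y)"
    and "(\<integral>(y, x). x $ i * y \<partial>obs_law k) = (second_moment_matrix (FX k) *v b k) $ i"
proof -
  interpret FX: prob_space "FX k" by (rule prob_space_FX)
  interpret Fe: prob_space "Fe k" by (rule prob_space_Fe)
  interpret pair_prob_space "FX k" "Fe k" ..
  note map = measurable_response_map[of "b k" k]
  have mX: "(\<lambda>x. x $ i) \<in> borel_measurable (FX k)" for i
    unfolding measurable_cong_sets[OF sets_FX refl] by simp
  have int_X: "integrable (FX k) (\<lambda>x. x $ i)" for i
    by (rule FX.square_integrable_imp_integrable[OF mX]) (use sq[of i i] in \<open>simp add: power2_eq_square\<close>)
  have prod1: "integrable (FX k \<Otimes>\<^sub>M Fe k) (\<lambda>(x, e). x $ i * x $ l)"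
    "(\<integral>(x, e). x $ i * x $ l \<partial>(FX k \<Otimes>\<^sub>M Fe k)) = second_moment_matrix (FX k) $ i $ l" for i l
    using product_integral[OF prob_space_FX prob_space_Fe[of k] sq[of i l], where g="\<lambda>_. 1"]
    by (auto simp: second_moment_matrix_def Fe.prob_space)
  have prod2: "integrable (FX k \<Otimes>\<^sub>M Fe k) (\<lambda>(x, e). x $ i * e)"
    "(\<integral>(x, e). x $ i * e \<partial>(FX k \<Otimes>\<^sub>M Fe k)) = 0"
    using product_integral[OF prob_space_FX prob_space_Fe int_X[of i] error_integrable[of k]]
    by (auto simp: error_mean_zero)
  have [measurable]: "(\<lambda>z :: real \<times> (real ^ 'd). snd z $ i) \<in> borel_measurable (borel \<Otimes>\<^sub>M borel)" for i
    by (rule measurable_compose[OF measurable_snd]) simp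
  have m1: "(\<lambda>(y :: real, x :: real ^ 'd). x $ i * x $ l) \<in> borel_measurable (borel \<Otimes>\<^sub>M borel)"
    and m2: "(\<lambda>(y, x :: real ^ 'd). x $ i * y) \<in> borel_measurable (borel \<Otimes>\<^sub>M borel)" for i l
    unfolding case_prod_unfold by measurable
  have cross: "(case z of (x, e) \<Rightarrow> x $ i * (b k \<bullet> x + e))
      = (\<Sum>l\<in>UNIV. b k $ l * (case z of (x, e) \<Rightarrow> x $ i * x $ l)) + (case z of (x, e) \<Rightarrow> x $ i * e)" for z
    by (simp add: case_prod_beta inner_sum_mult distrib_left sum_distrib_left mult_ac)
  have int_term: "integrable (FX k \<Otimes>\<^sub>M Fe k) (\<lambda>z. b k $ l * (case z of (x, e) \<Rightarrow> x $ i * x $ l))" for l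
    by (intro integrable_mult_right prod1)
  have int_sum: "integrable (FX k \<Otimes>\<^sub>M Fe k)
      (\<lambda>z. \<Sum>l\<in>UNIV. b k $ l * (case z of (x, e) \<Rightarrow> x $ i * x $ l))"
    by (intro Bochner_Integration.integrable_sum int_term)
  show "integrable (obs_law k) (\<lambda>(y, x). x $ i * x $ l)"
    unfolding component_law_def integrable_distr_eq[OF map m1] using prod1 by (simp add: case_prod_unfold)
  show "(\<integral>(y, x). x $ i * x $ l \<partial>obs_law k) = second_moment_matrix (FX k) $ i $ l"
    unfolding component_law_def integral_distr[OF map m1] using prod1 by (simp add: case_prod_unfold)
  have "integrable (FX k \<Otimes>\<^sub>M Fe k) (\<lambda>z. case z of (x, e) \<Rightarrow> x $ i * (b k \<bullet> x + e))"
    unfolding cross by (intro Bochner_Integration.integrable_add int_sum prod2)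
  then show "integrable (obs_law k) (\<lambda>(y, x). x $ i * y)"
    unfolding component_law_def integrable_distr_eq[OF map m2] by (simp add: case_prod_unfold)
  have "(\<integral>z. (case z of (x, e) \<Rightarrow> x $ i * (b k \<bullet> x + e)) \<partial>(FX k \<Otimes>\<^sub>M Fe k))
      = (\<Sum>l\<in>UNIV. b k $ l * second_moment_matrix (FX k) $ i $ l)"
    unfolding cross Bochner_Integration.integral_add[OF int_sum prod2(1)]
      Bochner_Integration.integral_sum[OF int_term]
    by (simp add: prod1 prod2)
  then show "(\<integral>(y, x). x $ i * y \<partial>obs_law k) = (second_moment_matrix (FX k) *v b k) $ i"
    unfolding component_law_def integral_distr[OF map m2]
    by (simp add: case_prod_unfold matrix_vector_mult_def mult.commute)
qed

end

section \<open>Consistency of the estimator\<close>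

text \<open>
  The normal equations are divided by \<open>N\<close>, because only then do the matrix and the
  right-hand side converge.
\<close>

lemma scaled_mvc_ls_solves:
  fixes p :: "nat \<Rightarrow> nat \<Rightarrow> real ^ 'k" and m :: 'k and N :: nat
    and x :: "nat \<Rightarrow> real ^ 'd" and y :: "nat \<Rightarrow> real" and v :: "real ^ 'd"
  defines "a \<equiv> minimax_weight p m N"
  assumes N: "N \<ge> 1" and \<Gamma>: "invertible (conc_gram p N)"
    and inv: "invertible ((1 / real N) *\<^sub>R weighted_gram N a x)"
  shows "((1 / real N) *\<^sub>R weighted_gram N a x) *v mvc_ls p m N x y v
           = (1 / real N) *\<^sub>R weighted_cross N a x y"
proof -
  have "real N *\<^sub>R ((1 / real N) *\<^sub>R weighted_gram N a x) = weighted_gram N a x"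
    using N by simp
  then have "invertible (weighted_gram N a x)"
    using scalar_invertible[OF _ inv, of "real N"] N by simp
  then have "weighted_gram N a x *v mvc_ls p m N x y v = weighted_cross N a x y"
    using \<Gamma> by (simp add: mvc_ls_def a_def[symmetric] Let_def matrix_vector_mul_assoc matrix_inv_inverse)
  then show ?thesis
    by (simp add: scaleR_matrix_vector_assoc[symmetric])
qed

theorem theorem1:
  fixes P :: "nat \<Rightarrow> 'w measure"
    and p :: "nat \<Rightarrow> nat \<Rightarrow> real ^ 'k::finite"
    and \<kappa> :: "nat \<Rightarrow> nat \<Rightarrow> 'w \<Rightarrow> 'k"
    and X :: "nat \<Rightarrow> nat \<Rightarrow> 'w \<Rightarrow> real ^ 'd::finite"
    and \<epsilon> Y :: "nat \<Rightarrow> nat \<Rightarrow> 'w \<Rightarrow> real"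
    and b :: "'k \<Rightarrow> real ^ 'd"
    and FX :: "'k \<Rightarrow> (real ^ 'd) measure"
    and Fe :: "'k \<Rightarrow> real measure"
    and v :: "nat \<Rightarrow> 'w \<Rightarrow> real ^ 'd"
    and m :: 'k
  assumes "mixture_regression P p \<kappa> X \<epsilon> Y b FX Fe"
    and "\<And>k i l. integrable (FX k) (\<lambda>x. x $ i * x $ l)"
    and "\<And>k. integrable (Fe k) (\<lambda>e. e\<^sup>2)"
    and "invertible (second_moment_matrix (FX m))"
    and "\<exists>C>0. \<forall>\<^sub>F N in sequentially. det (conc_gram p N) > C"
    and "\<And>N. N \<ge> 1 \<Longrightarrow> v N \<in> borel_measurable (P N)"
  shows "\<forall>\<delta>>0. (\<lambda>N. measure (P N) {\<omega> \<in> space (P N).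
           dist (mvc_ls p m N (\<lambda>j. X N j \<omega>) (\<lambda>j. Y N j \<omega>) (v N \<omega>)) (b m) > \<delta>})
         \<longlonglongrightarrow> 0"
proof (intro allI impI)
  fix \<delta> :: real assume \<delta>: "\<delta> > 0"
  interpret mixture_regression P p \<kappa> X \<epsilon> Y b FX Fe by fact
  note moments = second_moments_of_observation[OF assms(2)]
  obtain C where C: "C > 0" "\<forall>\<^sub>F N in sequentially. det (conc_gram p N) > C"
    using assms(5) by blast
  let ?D = "second_moment_matrix (FX m)" and ?a = "minimax_weight p m"
  obtain \<eta> where \<eta>: "\<eta> > 0" and stable: "\<And>A' h x'. (\<And>i l. \<bar>A' $ i $ l - ?D $ i $ l\<bar> < \<eta>) \<Longrightarrow>
       (\<And>i. \<bar>h $ i - (?D *v b m) $ i\<bar> < \<eta>) \<Longrightarrow>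
       invertible A' \<and> (A' *v x' = h \<longrightarrow> dist x' (b m) < \<delta>)"
    using continuous_linear_solution[OF assms(4) \<delta>, of "b m"] by blast
  define G where "G N i l \<omega> = (\<Sum>j=1..N. ?a N j * (X N j \<omega> $ i * X N j \<omega> $ l)) / real N - ?D $ i $ l"
    for N i l \<omega>
  define H where "H N i \<omega> = (\<Sum>j=1..N. ?a N j * (X N j \<omega> $ i * Y N j \<omega>)) / real N - (?D *v b m) $ i"
    for N i \<omega>
  have limG: "(\<lambda>N. measure (P N) {\<omega> \<in> space (P N). \<bar>G N i l \<omega>\<bar> \<ge> \<eta>}) \<longlonglongrightarrow> 0" for i l
    using weighted_mean_tendsto_in_probability[OF moments(1) C \<eta>, of m i l]
    by (simp add: G_def moments)
  have limH: "(\<lambda>N. measure (P N) {\<omega> \<in> space (P N). \<bar>H N i \<omega>\<bar> \<ge> \<eta>}) \<longlonglongrightarrow> 0" for i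
    using weighted_mean_tendsto_in_probability[OF moments(3) C \<eta>, of m i]
    by (simp add: H_def moments)
  let ?bound = "\<lambda>N. (\<Sum>i\<in>UNIV. \<Sum>l\<in>UNIV. measure (P N) {\<omega> \<in> space (P N). \<bar>G N i l \<omega>\<bar> \<ge> \<eta>})
      + (\<Sum>i\<in>UNIV. measure (P N) {\<omega> \<in> space (P N). \<bar>H N i \<omega>\<bar> \<ge> \<eta>})"
  have "?bound \<longlonglongrightarrow> (\<Sum>i\<in>(UNIV :: 'd set). \<Sum>l\<in>(UNIV :: 'd set). 0) + (\<Sum>i\<in>(UNIV :: 'd set). 0)"
    by (intro tendsto_add tendsto_sum limG limH)
  then have lim: "?bound \<longlonglongrightarrow> 0" by simp
  let ?E = "\<lambda>N. {\<omega> \<in> space (P N).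
      dist (mvc_ls p m N (\<lambda>j. X N j \<omega>) (\<lambda>j. Y N j \<omega>) (v N \<omega>)) (b m) > \<delta>}"
  have le: "eventually (\<lambda>N. measure (P N) (?E N) \<le> ?bound N) sequentially"
    using C(2) eventually_ge_at_top[of 1]
  proof eventually_elim
    case (elim N)
    interpret prob_space "P N" by (rule prob_space_P) fact
    have \<Gamma>: "invertible (conc_gram p N)" using elim C(1) by (simp add: invertible_det_nz)
    have [measurable]: "(\<lambda>\<omega>. X N j \<omega> $ i) \<in> borel_measurable (P N)" "Y N j \<in> borel_measurable (P N)"
      if "j \<in> {1..N}" for i j
      using measurable_observation(2,5)[OF that] by auto
    have mG[measurable]: "G N i l \<in> borel_measurable (P N)" for i l
      unfolding G_def[abs_def] by measurable
    have mH[measurable]: "H N i \<in> borel_measurable (P N)" for i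
      unfolding H_def[abs_def] by measurable
    let ?UG = "\<Union>i. \<Union>l. {\<omega> \<in> space (P N). \<bar>G N i l \<omega>\<bar> \<ge> \<eta>}"
    let ?UH = "\<Union>i. {\<omega> \<in> space (P N). \<bar>H N i \<omega>\<bar> \<ge> \<eta>}"
    \<comment> \<open>A set that is not measurable has \<open>measure\<close> zero, so the inclusion in a measurable set
      suffices to bound the measure of \<open>?E N\<close>.\<close>
    have "?E N \<subseteq> ?UG \<union> ?UH"
    proof (rule subsetI, rule ccontr)
      fix \<omega> assume \<omega>: "\<omega> \<in> ?E N" "\<omega> \<notin> ?UG \<union> ?UH"
      let ?W = "(1 / real N) *\<^sub>R weighted_gram N (?a N) (\<lambda>j. X N j \<omega>)"
      let ?c = "(1 / real N) *\<^sub>R weighted_cross N (?a N) (\<lambda>j. X N j \<omega>) (\<lambda>j. Y N j \<omega>)"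
      have *: "\<bar>?W $ i $ l - ?D $ i $ l\<bar> < \<eta>" "\<bar>?c $ i - (?D *v b m) $ i\<bar> < \<eta>" for i l
        using \<omega> by (auto simp: G_def H_def weighted_gram_def weighted_cross_def mult_ac not_le)
      have "invertible ?W" using stable[OF *] by blast
      with stable[OF *] scaled_mvc_ls_solves[OF elim(2) \<Gamma>]
      have "dist (mvc_ls p m N (\<lambda>j. X N j \<omega>) (\<lambda>j. Y N j \<omega>) (v N \<omega>)) (b m) < \<delta>" by blast
      with \<omega>(1) show False by auto
    qed
    then have "prob (?E N) \<le> prob (?UG \<union> ?UH)"
      by (intro finite_measure_mono) measurable
    also have "\<dots> \<le> prob ?UG + prob ?UH"
      by (intro measure_Un_le) measurable
    also have "\<dots> \<le> ?bound N"
    proof (intro add_mono)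
      show "prob ?UH \<le> (\<Sum>i\<in>UNIV. prob {\<omega> \<in> space (P N). \<bar>H N i \<omega>\<bar> \<ge> \<eta>})"
        by (intro measure_UNION_le) auto
      have "prob ?UG \<le> (\<Sum>i\<in>UNIV. prob (\<Union>l. {\<omega> \<in> space (P N). \<bar>G N i l \<omega>\<bar> \<ge> \<eta>}))"
        by (intro measure_UNION_le) auto
      also have "\<dots> \<le> (\<Sum>i\<in>UNIV. \<Sum>l\<in>UNIV. prob {\<omega> \<in> space (P N). \<bar>G N i l \<omega>\<bar> \<ge> \<eta>})"
        by (intro sum_mono measure_UNION_le) auto
      finally show "prob ?UG \<le> (\<Sum>i\<in>UNIV. \<Sum>l\<in>UNIV. prob {\<omega> \<in> space (P N). \<bar>G N i l \<omega>\<bar> \<ge> \<eta>})" .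
    qed
    finally show ?case .
  qed
  show "(\<lambda>N. measure (P N) (?E N)) \<longlonglongrightarrow> 0"
    by (rule tendsto_sandwich[OF _ le tendsto_const lim]) simp
qed

end
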